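(* Let $p$ be an odd prime, let $a$ be a positive integer, let $m$ be an integer not divisible by $p$, and set $\Delta=m(m-4)$. Then $$\sum_{k=0}^{p^a-1}\frac{\binom{2k}k}{m^k}\equiv\left(\frac{\Delta}{p^a}\right)+\left(\frac{\Delta}{p^{a-1}}\right)u_{p-(\frac{\Delta}{p})}(m-2,1)\pmod{p^2},$$ $$\sum_{k=0}^{p^a-1}\frac{\binom{2k}{k+1}}{m^k}\equiv 1-m^{p-1}+\left(\frac m2-1\right)\left(\left(\frac{\Delta}{p^a}\right)-1\right)+\left(\frac m2-1\right)\left(\frac{\Delta}{p^{a-1}}\right)u_{p-(\frac{\Delta}{p})}(m-2,1)\pmod{p^2}.$$ Consequently, $$\sum_{k=1}^{p^a-1}\frac{\binom{2k+1}k}{m^k}+m^{p-1}-1\equiv\frac m2\left(\left(\frac{\Delta}{p^a}\right)-1+\left(\frac{\Delta}{p^{a-1}}\right)u_{p-(\frac{\Delta}p)}(m-2,1)\right)\pmod{p^2}$$ and $$\sum_{k=1}^{p^a-1}\frac{C_k}{m^k}\equiv m^{p-1}-1-\frac{m-4}2\left(\left(\frac{\Delta}{p^a}\right)-1\right)-\frac{m-4}2\left(\frac{\Delta}{p^{a-1}}\right)u_{p-(\frac{\Delta}{p})}(m-2,1)\pmod{p^2}.$$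
   Context: For integers $A,B$ the Lucas sequence $u_n(A,B)$ is defined by $u_0=0$, $u_1=1$, $u_{n+1}=Au_n-Bu_{n-1}$ for $n\ge1$. $(\frac{\cdot}{\cdot})$ denotes the Jacobi symbol (so $(\frac{\Delta}{p^0})=1$ and $(\frac{\Delta}{p^j})=(\frac{\Delta}{p})^j$). $C_k=\binom{2k}k/(k+1)$ is the $k$-th Catalan number. For rationals $x,y$ whose denominators are prime to $p$, $x\equiv y\pmod{p^2}$ means that $x-y$ equals $p^2$ times a rational number with denominator prime to $p$. *)

theory Defs
  imports "HOL-Number_Theory.Number_Theory"
begin

fun lucas_u :: "int \<Rightarrow> int \<Rightarrow> nat \<Rightarrow> int" where
  "lucas_u A B 0 = 0"
| "lucas_u A B (Suc 0) = 1"
| "lucas_u A B (Suc (Suc n)) = A * lucas_u A B (Suc n) - B * lucas_u A B n"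

text \<open>
  Meaningful for odd \<open>n\<close> only: at the prime 2 the library's \<^const>\<open>Legendre\<close> is not the
  Kronecker symbol.
\<close>

definition Jacobi :: "int \<Rightarrow> nat \<Rightarrow> int" where
  "Jacobi a n = (\<Prod>q\<in>#prime_factorization n. Legendre a (int q))"

lemma Jacobi_prime_power:
  assumes "prime p"
  shows "Jacobi a (p ^ j) = Legendre a (int p) ^ j"
  using assms by (simp add: Jacobi_def prime_factorization_prime_power)

definition catalan :: "nat \<Rightarrow> rat" where
  "catalan k = of_nat ((2 * k) choose k) / of_nat (k + 1)"

definition p_integral :: "nat \<Rightarrow> rat \<Rightarrow> bool" where
  "p_integral p x \<longleftrightarrow> coprime (snd (quotient_of x)) (int p)"

text \<open>
  Congruence modulo \<open>p\<^sup>2\<close> in the ring of rationals with denominator prime to \<open>p\<close>; it is meant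
  for \<open>x\<close> and \<open>y\<close> in that ring. The library's \<^const>\<open>cong\<close> is of no use for rationals: in a
  field every element is divisible by the nonzero element \<open>p\<^sup>2\<close>.
\<close>

definition rat_cong_sq :: "nat \<Rightarrow> rat \<Rightarrow> rat \<Rightarrow> bool" where
  "rat_cong_sq p x y \<longleftrightarrow> (\<exists>z. p_integral p z \<and> x - y = of_nat p ^ 2 * z)"

end

theory Submission
  imports Defs
begin

text \<open>
  Write \<open>u\<close> for the Lucas sequence with parameters \<open>(m - 2, 1)\<close>, \<open>S\<close> for the shift operator,
  \<open>q = p\<^sup>a = 2h + 1\<close>, and \<open>M = m\<^sup>h\<close>. The sum of \<open>(2k choose k + d) m\<^sup>q\<^sup>-\<^sup>1\<^sup>-\<^sup>k\<close> over \<open>k < q\<close> equals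
  the sum of \<open>(2q choose k) u(q - d - k)\<close> over \<open>k < q - d\<close>. By Vandermonde,
  \<open>(2q choose k) \<equiv> 2 (q choose k)\<close> modulo \<open>p\<^sup>2\<close> for \<open>0 < k < q\<close>, so the sum is a value of
  \<open>2 (1 + S)\<^sup>q u\<close> up to boundary terms, and \<open>(1 + S)\<^sup>2 u = m S u\<close> turns \<open>(1 + S)\<^sup>q\<close> into
  \<open>M S\<^sup>h (1 + S)\<close>. This leaves polynomials in \<open>M\<close>, \<open>x = u(h)\<close> and \<open>y = u(h + 1)\<close>, subject to
  \<open>y\<^sup>2 - (m - 2) x y + x\<^sup>2 = 1\<close> and \<open>M \<equiv> y - x\<close> modulo \<open>p\<close>; the latter makes the terms of
  first order in \<open>p\<close> cancel. The result involves \<open>u(q - e\<^sup>a)\<close> with \<open>e\<close> the Legendre symbol of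
  \<open>m (m - 4)\<close>; as \<open>p - e\<close> divides \<open>q - e\<^sup>a\<close> with quotient \<open>\<equiv> e\<^sup>a\<^sup>-\<^sup>1\<close> and \<open>p\<close> divides
  \<open>u(p - e)\<close>, this is \<open>e\<^sup>a\<^sup>-\<^sup>1 u(p - e)\<close> modulo \<open>p\<^sup>2\<close>.
\<close>

section \<open>Central binomial sums as binomial sums of Lucas numbers\<close>

text \<open>Pascal's rule. Read with a shift operator \<open>S\<close>, it peels one factor off
  \<open>(1 + S) ^ Suc n\<close>; the inductions on binomial sums below rest on it.\<close>

lemma sum_choose_Suc:
  fixes g :: "nat \<Rightarrow> int"
  shows "(\<Sum>k\<le>Suc n. of_nat (Suc n choose k) * g k) = (\<Sum>k\<le>n. of_nat (n choose k) * (g k + g (Suc k)))"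
proof -
  have "(\<Sum>k\<le>Suc n. of_nat (Suc n choose k) * g k)
      = g 0 + (\<Sum>k\<le>n. of_nat ((n choose k) + (n choose Suc k)) * g (Suc k))"
    by (subst sum.atMost_Suc_shift) simp
  also have "\<dots> = (g 0 + (\<Sum>k\<le>n. of_nat (n choose Suc k) * g (Suc k))) + (\<Sum>k\<le>n. of_nat (n choose k) * g (Suc k))"
    by (simp add: algebra_simps sum.distrib)
  also have "g 0 + (\<Sum>k\<le>n. of_nat (n choose Suc k) * g (Suc k)) = (\<Sum>k\<le>Suc n. of_nat (n choose k) * g k)"
    by (subst sum.atMost_Suc_shift) simp
  also have "\<dots> = (\<Sum>k\<le>n. of_nat (n choose k) * g k)"
    by simp
  finally show ?thesis by (simp add: algebra_simps sum.distrib)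
qed

text \<open>The subtraction \<open>n - d - k\<close> is truncated, so the terms with \<open>k \<ge> n - d\<close> vanish.\<close>

lemma central_sum_eq_lucas_sum:
  fixes m :: int
  shows "(\<Sum>k<n. int ((2 * k) choose (k + d)) * m ^ (n - 1 - k))
       = (\<Sum>k\<le>2 * n. int ((2 * n) choose k) * lucas_u (m - 2) 1 (n - d - k))"
proof (induction n)
  case 0
  then show ?case by simp
next
  case (Suc n)
  let ?u = "lucas_u (m - 2) 1"
  \<comment> \<open>This is \<open>(1 + S)^2 u = m S u\<close> except at \<open>k + d = n\<close>:
    there the last index truncates to 0, where the two-sided sequence would have the value -1, so 1
    is left over.\<close>
  have rec: "?u (Suc n - d - k) + 2 * ?u (Suc n - d - Suc k) + ?u (Suc n - d - Suc (Suc k))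
      = m * ?u (n - d - k) + (if k + d = n then 1 else 0)" for k
  proof -
    consider "k + d > n" | "k + d = n" | j where "n = k + d + Suc j"
      by (metis less_imp_Suc_add linorder_neqE_nat add_Suc_right)
    then show ?thesis
    proof cases
      case 3
      then have "Suc n - d - k = Suc (Suc j)" "Suc n - d - Suc k = Suc j"
        "Suc n - d - Suc (Suc k) = j" "n - d - k = Suc j" by auto
      then show ?thesis using 3 by (simp add: algebra_simps)
    next
      case 2
      then have "Suc n - d - k = Suc 0" "Suc n - d - Suc k = 0"
        "Suc n - d - Suc (Suc k) = 0" "n - d - k = 0" by auto
      then show ?thesis using 2 by simp
    next
      case 1
      then have "Suc n - d - k = 0" "Suc n - d - Suc k = 0"
        "Suc n - d - Suc (Suc k) = 0" "n - d - k = 0" by auto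
      then show ?thesis using 1 by simp
    qed
  qed
  \<comment> \<open>The leftover 1 produces, after reflecting \<open>n - d\<close> to
    \<open>n + d\<close>, the summand that enters the central sum when \<open>n\<close> grows by
    one.\<close>
  have delta: "(\<Sum>k\<le>2 * n. int ((2 * n) choose k) * (if k + d = n then 1 else 0)) = int ((2 * n) choose (n + d))"
  proof (cases "d \<le> n")
    case True
    have "(\<Sum>k\<le>2 * n. int ((2 * n) choose k) * (if k + d = n then 1 else 0))
       = (\<Sum>k\<le>2 * n. if k = n - d then int ((2 * n) choose (n - d)) else 0)"
      using True by (intro sum.cong) auto
    also have "\<dots> = int ((2 * n) choose (n - d))" by (simp add: sum.delta')
    also have "(2 * n) choose (n - d) = (2 * n) choose (n + d)"
      using True binomial_symmetric[of "n - d" "2 * n"] by (simp add: mult_2 add.commute)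
    finally show ?thesis .
  next
    case False
    then show ?thesis by (auto intro!: sum.neutral)
  qed
  have "(\<Sum>k\<le>2 * Suc n. int ((2 * Suc n) choose k) * ?u (Suc n - d - k))
      = (\<Sum>k\<le>Suc (Suc (2 * n)). int (Suc (Suc (2 * n)) choose k) * ?u (Suc n - d - k))"
    by simp
  also have "\<dots> = (\<Sum>k\<le>2 * n. int ((2 * n) choose k) *
        (?u (Suc n - d - k) + 2 * ?u (Suc n - d - Suc k) + ?u (Suc n - d - Suc (Suc k))))"
    unfolding sum_choose_Suc[of "Suc (2 * n)"] sum_choose_Suc[of "2 * n"] by (simp add: algebra_simps)
  also have "\<dots> = m * (\<Sum>k\<le>2 * n. int ((2 * n) choose k) * ?u (n - d - k))
      + (\<Sum>k\<le>2 * n. int ((2 * n) choose k) * (if k + d = n then 1 else 0))"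
    unfolding rec by (simp add: distrib_left sum.distrib sum_distrib_left mult.left_commute del: mult_Suc_right)
  also have "\<dots> = m * (\<Sum>k<n. int ((2 * k) choose (k + d)) * m ^ (n - 1 - k)) + int ((2 * n) choose (n + d))"
    using Suc.IH delta by simp
  also have "m * (\<Sum>k<n. int ((2 * k) choose (k + d)) * m ^ (n - 1 - k))
      = (\<Sum>k<n. int ((2 * k) choose (k + d)) * m ^ (n - k))"
    unfolding sum_distrib_left
  proof (rule sum.cong)
    fix k assume "k \<in> {..<n}"
    then have "n - k = Suc (n - 1 - k)" by auto
    then show "m * (int ((2 * k) choose (k + d)) * m ^ (n - 1 - k)) = int ((2 * k) choose (k + d)) * m ^ (n - k)"
      by simp
  qed simp
  finally show ?case by simp
qed

section \<open>Lucas sequences at integer indices\<close>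

text \<open>As the second parameter is 1, the recurrence is symmetric under reversal of indices, so
  the odd extension satisfies it at all integers. This makes the shift invertible and gives boundary
  values such as the one at -1.\<close>

definition lucas_int :: "int \<Rightarrow> int \<Rightarrow> int" where
  "lucas_int A i = (if i \<ge> 0 then lucas_u A 1 (nat i) else - lucas_u A 1 (nat (- i)))"

lemma lucas_int_of_nat [simp]: "lucas_int A (int n) = lucas_u A 1 n"
  by (simp add: lucas_int_def)

lemma lucas_int_0 [simp]: "lucas_int A 0 = 0"
  and lucas_int_1 [simp]: "lucas_int A 1 = 1"
  by (simp_all add: lucas_int_def)

lemma lucas_int_uminus: "lucas_int A (- i) = - lucas_int A i"
  by (auto simp: lucas_int_def)

lemma lucas_int_rec: "lucas_int A (i + 1) = A * lucas_int A i - lucas_int A (i - 1)"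
proof -
  have pos: "lucas_int A (int (Suc n) + 1) = A * lucas_int A (int (Suc n)) - lucas_int A (int (Suc n) - 1)" for n
  proof -
    have "int (Suc n) + 1 = int (Suc (Suc n))" "int (Suc n) - 1 = int n"
      by simp_all
    then show ?thesis
      unfolding lucas_int_of_nat by (simp only: lucas_int_of_nat lucas_u.simps mult_1)
  qed
  consider n where "i = int (Suc n)" | "i = 0" | n where "i = - int (Suc n)"
    by (metis gr0_implies_Suc int_cases3 )
  then show ?thesis
  proof cases
    case 1
    then show ?thesis using pos by blast
  next
    case 2
    then show ?thesis using lucas_int_uminus[of A 1] by simp
  next
    case 3
    have "lucas_int A (i + 1) = - lucas_int A (int (Suc n) - 1)"
      "lucas_int A (i - 1) = - lucas_int A (int (Suc n) + 1)"
      "lucas_int A i = - lucas_int A (int (Suc n))"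
      unfolding 3 lucas_int_uminus[symmetric] by simp_all
    then show ?thesis using pos[of n] by simp
  qed
qed

lemma lucas_int_pred: "lucas_int A (i - 1) = A * lucas_int A i - lucas_int A (i + 1)"
  by (simp add: lucas_int_rec)

text \<open>A two-sided solution is fixed by its values at 0 and 1, and the right-hand side is a
  solution with the same two values. Applied to translates of the sequence it gives the addition
  formula.\<close>

lemma recurrence_eq_lucas_int:
  fixes f :: "int \<Rightarrow> int"
  assumes rec: "\<And>i. f (i + 1) = A * f i - f (i - 1)"
  shows "f j = f 1 * lucas_int A j - f 0 * lucas_int A (j - 1)"
proof -
  let ?g = "\<lambda>j. f 1 * lucas_int A j - f 0 * lucas_int A (j - 1)"
  have g: "?g (i + 1) = A * ?g i - ?g (i - 1)" for i
    using lucas_int_rec[of A i] lucas_int_rec[of A "i - 1"] by (simp add: right_diff_distrib mult.left_commute)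
  have "f j = ?g j \<and> f (j + 1) = ?g (j + 1)"
  proof (induction j rule: int_induct[where k = 0])
    case base
    show ?case using lucas_int_uminus[of A 1] by simp
  next
    case (step1 i)
    then show ?case using rec[of "i + 1"] g[of "i + 1"] by simp
  next
    case (step2 i)
    have "f (i - 1) = A * f i - f (i + 1)" "?g (i - 1) = A * ?g i - ?g (i + 1)"
      using rec[of i] g[of i] by linarith+
    then show ?case using step2 by simp
  qed
  then show ?thesis by blast
qed

lemma lucas_int_add:
  "lucas_int A (i + j) = lucas_int A (i + 1) * lucas_int A j - lucas_int A i * lucas_int A (j - 1)"
proof -
  have "lucas_int A (i + (k + 1)) = A * lucas_int A (i + k) - lucas_int A (i + (k - 1))" for k
    using lucas_int_rec[of A "i + k"] by (simp add: algebra_simps)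
  from recurrence_eq_lucas_int[of "\<lambda>k. lucas_int A (i + k)", OF this, of j] show ?thesis by simp
qed

lemma lucas_int_cassini:
  "(lucas_int A (i + 1))\<^sup>2 - A * lucas_int A i * lucas_int A (i + 1) + (lucas_int A i)\<^sup>2 = 1"
proof -
  \<comment> \<open>The addition formula for two indices with sum 1.\<close>
  have "1 = (lucas_int A i)\<^sup>2 - lucas_int A (i + 1) * lucas_int A (i - 1)"
    using lucas_int_add[of A i "1 - i"] lucas_int_uminus[of A i] lucas_int_uminus[of A "i - 1"]
    by (simp add: power2_eq_square)
  then show ?thesis
    unfolding lucas_int_pred by (simp add: algebra_simps power2_eq_square)
qed

lemma lucas_int_odd_index:
  "lucas_int A (2 * i + 1) = (lucas_int A (i + 1))\<^sup>2 - (lucas_int A i)\<^sup>2"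
  using lucas_int_add[of A i "i + 1"] by (simp add: algebra_simps power2_eq_square)

lemma lucas_int_even_index:
  "lucas_int A (2 * i) = 2 * lucas_int A i * lucas_int A (i + 1) - A * (lucas_int A i)\<^sup>2"
proof -
  have "lucas_int A (2 * i) = lucas_int A (i + 1) * lucas_int A i - lucas_int A i * lucas_int A (i - 1)"
    using lucas_int_add[of A i i] by simp
  then show ?thesis
    unfolding lucas_int_pred by (simp add: algebra_simps power2_eq_square)
qed

section \<open>Shift operators on integer sequences\<close>

text \<open>In terms of the shift \<open>S\<close> this is \<open>S^s + c S^t\<close>, which covers
  both \<open>1 + S\<close> and \<open>S - S^-1\<close>.\<close>

definition two_shift :: "int \<Rightarrow> int \<Rightarrow> int \<Rightarrow> (int \<Rightarrow> int) \<Rightarrow> int \<Rightarrow> int" where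
  "two_shift c s t f i = f (i + s) + c * f (i + t)"

text \<open>The binomial theorem for the commuting operators \<open>S^s\<close> and
  \<open>c S^t\<close>.\<close>

lemma two_shift_funpow:
  "(two_shift c s t ^^ n) f i
    = (\<Sum>k\<le>n. int (n choose k) * (c ^ (n - k) * f (i + int k * s + int (n - k) * t)))"
proof (induction n arbitrary: i)
  case 0
  then show ?case by simp
next
  case (Suc n)
  have "(two_shift c s t ^^ Suc n) f i
     = (two_shift c s t ^^ n) f (i + s) + c * (two_shift c s t ^^ n) f (i + t)"
    by (simp add: two_shift_def)
  also have "\<dots> = (\<Sum>k\<le>n. int (n choose k) * (c ^ (Suc n - k) * f (i + int k * s + int (Suc n - k) * t)
      + c ^ (Suc n - Suc k) * f (i + int (Suc k) * s + int (Suc n - Suc k) * t)))"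
    unfolding Suc.IH sum_distrib_left sum.distrib[symmetric]
    by (intro sum.cong) (auto simp: algebra_simps Suc_diff_le)
  also have "\<dots> = (\<Sum>k\<le>Suc n. int (Suc n choose k) * (c ^ (Suc n - k) * f (i + int k * s + int (Suc n - k) * t)))"
    by (rule sum_choose_Suc[symmetric])
  finally show ?case .
qed

text \<open>The operator commutes with scalars and translations, so the hypothesis on
  \<open>f\<close> passes to all multiples of translates of \<open>f\<close>. Each pair of
  applications gives a factor \<open>D\<close> and a shift by \<open>r\<close>, and one application
  remains.\<close>

lemma two_shift_funpow_odd:
  assumes "\<And>i. two_shift c s t (two_shift c s t f) i = D * f (i + r)"
  shows "(two_shift c s t ^^ (2 * n + 1)) f i = D ^ n * two_shift c s t f (i + int n * r)"
proof (induction n arbitrary: i)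
  case 0
  then show ?case by simp
next
  case (Suc n)
  have *: "two_shift c s t (two_shift c s t (\<lambda>i. x * f (i + y))) i = x * (D * f (i + y + r))" for x y i
  proof -
    have "two_shift c s t (two_shift c s t (\<lambda>i. x * f (i + y))) i = x * two_shift c s t (two_shift c s t f) (i + y)"
      by (simp add: two_shift_def algebra_simps)
    then show ?thesis by (simp only: assms)
  qed
  have IH: "(two_shift c s t ^^ (2 * n + 1)) f = (\<lambda>i. D ^ n * f (i + (int n * r + s)) + D ^ n * c * f (i + (int n * r + t)))"
    unfolding fun_eq_iff Suc.IH two_shift_def[of c s t f] by (simp add: algebra_simps)
  have "(two_shift c s t ^^ (2 * Suc n + 1)) f i
      = two_shift c s t (two_shift c s t ((two_shift c s t ^^ (2 * n + 1)) f)) i"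
    by simp
  also have "\<dots> = two_shift c s t (two_shift c s t (\<lambda>i. D ^ n * f (i + (int n * r + s)))) i
      + two_shift c s t (two_shift c s t (\<lambda>i. (D ^ n * c) * f (i + (int n * r + t)))) i"
    unfolding IH by (simp add: two_shift_def algebra_simps)
  also have "\<dots> = D ^ Suc n * two_shift c s t f (i + int (Suc n) * r)"
    unfolding * by (simp add: two_shift_def algebra_simps)
  finally show ?case .
qed

text \<open>The recurrence says that \<open>S + S^-1\<close> acts as \<open>m - 2\<close>, so
  \<open>(1 + S)^2 = S (S + 2 + S^-1)\<close> acts as \<open>m S\<close>.\<close>

lemma two_shift_sq_lucas_int_sum:
  "two_shift 1 1 0 (two_shift 1 1 0 (lucas_int (m - 2))) i = m * lucas_int (m - 2) (i + 1)"
  using lucas_int_rec[of "m - 2" "i + 1"] by (simp add: two_shift_def algebra_simps)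

text \<open>Here \<open>(S - S^-1)^2 = (S + S^-1)^2 - 4\<close> acts as
  \<open>(m - 2)^2 - 4\<close>. The summand \<open>0\<close> fits the shape of
  \<open>two_shift_funpow_odd\<close> with \<open>r = 0\<close>.\<close>

lemma two_shift_sq_lucas_int_diff:
  "two_shift (- 1) 1 (- 1) (two_shift (- 1) 1 (- 1) (lucas_int (m - 2))) i
    = m * (m - 4) * lucas_int (m - 2) (i + 0)"
proof -
  let ?U = "lucas_int (m - 2)"
  have "?U (i + 2) = (m - 2) * ?U (i + 1) - ?U i" "?U (i - 2) = (m - 2) * ?U (i - 1) - ?U i"
    using lucas_int_rec[of "m - 2" "i + 1"] lucas_int_rec[of "m - 2" "i - 1"] by (simp_all add: algebra_simps)
  then have "?U (i + 2) - 2 * ?U i + ?U (i - 2) = (m - 2) * (?U (i + 1) + ?U (i - 1)) - 4 * ?U i"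
    by (simp add: algebra_simps)
  also have "?U (i + 1) + ?U (i - 1) = (m - 2) * ?U i"
    by (simp add: lucas_int_rec)
  finally show ?thesis
    by (simp add: two_shift_def algebra_simps)
qed

section \<open>Reduction modulo powers of the prime\<close>

text \<open>Since \<open>k * (q choose k) = q * (q - 1 choose k - 1)\<close> for
  \<open>q = p ^ a\<close>, a coefficient prime to \<open>p\<close> would force
  \<open>q dvd k\<close>.\<close>

lemma prime_dvd_prime_power_choose:
  fixes p :: nat
  assumes "prime p" "0 < k" "k < p ^ a"
  shows "p dvd (p ^ a choose k)"
proof (rule ccontr)
  assume "\<not> p dvd (p ^ a choose k)"
  then have "coprime (p ^ a) (p ^ a choose k)"
    using assms(1) by (simp add: prime_imp_coprime)
  moreover obtain j where j: "k = Suc j" using assms(2) gr0_implies_Suc by blast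
  obtain r where r: "p ^ a = Suc r" using assms(3) by (metis less_imp_Suc_add add_Suc_right)
  have "p ^ a dvd k * (p ^ a choose k)"
    using Suc_times_binomial_eq[of r j] unfolding j r by (metis dvd_triv_left mult.commute)
  ultimately have "p ^ a dvd k" by (simp add: coprime_dvd_mult_left_iff)
  with assms(2,3) show False by (auto dest: dvd_imp_le)
qed

lemma sum_prime_power_choose_cong:
  fixes g :: "nat \<Rightarrow> int"
  assumes "prime p" "a > 0"
  shows "[(\<Sum>k\<le>p ^ a. int (p ^ a choose k) * g k) = g 0 + g (p ^ a)] (mod int p)"
proof -
  have q: "p ^ a > 0" using assms(1) prime_gt_0_nat by simp
  have "{..p ^ a} = insert 0 (insert (p ^ a) {0<..<p ^ a})" using q by auto
  then have "(\<Sum>k\<le>p ^ a. int (p ^ a choose k) * g k)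
      = g 0 + g (p ^ a) + (\<Sum>k\<in>{0<..<p ^ a}. int (p ^ a choose k) * g k)"
    using q by simp
  moreover have "int p dvd (\<Sum>k\<in>{0<..<p ^ a}. int (p ^ a choose k) * g k)"
    using prime_dvd_prime_power_choose[OF assms(1)]
    by (intro dvd_sum dvd_mult2) auto
  ultimately show ?thesis by (simp add: cong_iff_dvd_diff)
qed

text \<open>By Vandermonde, all terms but the two extreme ones are products of two multiples of \<open>p\<close>.\<close>

lemma choose_double_prime_power_cong:
  assumes "prime p" "0 < k" "k < p ^ a"
  shows "[int ((2 * p ^ a) choose k) = 2 * int (p ^ a choose k)] (mod (int p)\<^sup>2)"
proof -
  let ?q = "p ^ a"
  have "int ((2 * ?q) choose k) = (\<Sum>j\<le>k. int (?q choose j) * int (?q choose (k - j)))"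
    unfolding mult_2 vandermonde[symmetric] by simp
  also have "{..k} = insert 0 (insert k {0<..<k})" using assms(2) by auto
  also have "(\<Sum>j\<in>insert 0 (insert k {0<..<k}). int (?q choose j) * int (?q choose (k - j)))
      = 2 * int (?q choose k) + (\<Sum>j\<in>{0<..<k}. int (?q choose j) * int (?q choose (k - j)))"
    using assms(2) by simp
  finally have "int ((2 * ?q) choose k) - 2 * int (?q choose k)
      = (\<Sum>j\<in>{0<..<k}. int (?q choose j) * int (?q choose (k - j)))" by simp
  moreover have "(int p)\<^sup>2 dvd \<dots>"
    unfolding power2_eq_square using assms
    by (intro dvd_sum mult_dvd_mono) (auto intro!: prime_dvd_prime_power_choose)
  ultimately show ?thesis by (simp add: cong_iff_dvd_diff)
qed

text \<open>Because \<open>d <= 1\<close>, no index \<open>p ^ a - d - k\<close> with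
  \<open>k < p ^ a\<close> is truncated, so \<open>lucas_int\<close> can replace
  \<open>lucas_u\<close> there; the terms with \<open>k >= p ^ a\<close> vanish.\<close>

lemma lucas_sum_prime_power_cong:
  assumes "prime p" "p ^ a = 2 * h + 1" "h > 0" "d \<le> 1"
  shows "[(\<Sum>k\<le>2 * p ^ a. int ((2 * p ^ a) choose k) * lucas_u (m - 2) 1 (p ^ a - d - k))
     = 2 * (m ^ h * (lucas_int (m - 2) (int h + 1 - int d) + lucas_int (m - 2) (int h - int d))
            - lucas_int (m - 2) (- int d))
       - lucas_int (m - 2) (int (p ^ a) - int d)] (mod (int p)\<^sup>2)"
proof -
  let ?q = "p ^ a" and ?U = "lucas_int (m - 2)"
  let ?g = "\<lambda>k. ?U (int ?q - int d - int k)"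
  have u: "lucas_u (m - 2) 1 (?q - d - k) = ?g k" if "k < ?q" for k
  proof -
    have "int ?q - int d - int k = int (?q - d - k)" using that assms(4) by simp
    then show ?thesis by (simp only: lucas_int_of_nat)
  qed
  have split: "{..?q} = insert 0 (insert ?q {0<..<?q})" using assms(2,3) by auto
  have "(\<Sum>k\<le>2 * ?q. int ((2 * ?q) choose k) * lucas_u (m - 2) 1 (?q - d - k))
      = (\<Sum>k\<in>insert 0 {0<..<?q}. int ((2 * ?q) choose k) * lucas_u (m - 2) 1 (?q - d - k))"
    using assms(2) by (intro sum.mono_neutral_right) auto
  also have "\<dots> = ?g 0 + (\<Sum>k\<in>{0<..<?q}. int ((2 * ?q) choose k) * ?g k)"
  proof -
    have "(\<Sum>k\<in>{0<..<?q}. int ((2 * ?q) choose k) * lucas_u (m - 2) 1 (?q - d - k))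
        = (\<Sum>k\<in>{0<..<?q}. int ((2 * ?q) choose k) * ?g k)"
      using u by (intro sum.cong) auto
    then show ?thesis using u[of 0] assms(2) by simp
  qed
  also have "[\<dots> = ?g 0 + (\<Sum>k\<in>{0<..<?q}. (2 * int (?q choose k)) * ?g k)] (mod (int p)\<^sup>2)"
    by (intro cong_add cong_sum cong_mult choose_double_prime_power_cong assms(1)) auto
  \<comment> \<open>Doubling the full sum counts \<open>k = 0\<close> once too often, and
    \<open>k = p ^ a\<close>, which is absent on the left, twice.\<close>
  also have "?g 0 + (\<Sum>k\<in>{0<..<?q}. (2 * int (?q choose k)) * ?g k)
      = 2 * (\<Sum>k\<le>?q. int (?q choose k) * ?g k) - 2 * ?g ?q - ?g 0"
    unfolding split using assms(2) by (simp add: sum_distrib_left mult.assoc)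
  \<comment> \<open>Reversing the order of summation exposes \<open>(1 + S) ^ q\<close> at the index
    \<open>- d\<close>.\<close>
  also have "(\<Sum>k\<le>?q. int (?q choose k) * ?g k) = (\<Sum>k\<le>?q. int (?q choose k) * ?U (int k - int d))"
    by (rule sum.reindex_bij_witness[where i = "\<lambda>k. ?q - k" and j = "\<lambda>k. ?q - k"])
       (auto simp: binomial_symmetric[symmetric] of_nat_diff algebra_simps)
  also have "\<dots> = (two_shift 1 1 0 ^^ ?q) ?U (- int d)"
    unfolding two_shift_funpow by (simp add: algebra_simps)
  also have "\<dots> = m ^ h * (?U (int h + 1 - int d) + ?U (int h - int d))"
    unfolding assms(2) two_shift_funpow_odd[OF two_shift_sq_lucas_int_sum]
    by (simp add: two_shift_def algebra_simps)
  finally show ?thesis by (simp add: algebra_simps)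
qed

text \<open>
  The next two lemmas expand \<open>(1 + S)\<^sup>q\<close> and \<open>(S - S\<^sup>-\<^sup>1)\<^sup>q\<close> for the shift \<open>S\<close>:
  modulo \<open>p\<close> only the two extreme binomial coefficients survive.
\<close>

lemma lucas_frobenius_sum_cong:
  assumes "prime p" "p ^ a = 2 * h + 1" "h > 0"
  shows "[m ^ h * (lucas_int (m - 2) (int h) + lucas_int (m - 2) (int h + 1))
     = lucas_int (m - 2) (int (p ^ a))] (mod int p)"
proof -
  have a: "a > 0" using assms(2,3) by (cases a) auto
  have "m ^ h * (lucas_int (m - 2) (int h) + lucas_int (m - 2) (int h + 1))
      = (two_shift 1 1 0 ^^ (p ^ a)) (lucas_int (m - 2)) 0"
    unfolding assms(2) two_shift_funpow_odd[OF two_shift_sq_lucas_int_sum]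
    by (simp add: two_shift_def algebra_simps)
  also have "[\<dots> = lucas_int (m - 2) (int (p ^ a))] (mod int p)"
    unfolding two_shift_funpow
    by (rule cong_trans[OF sum_prime_power_choose_cong[OF assms(1) a]]) simp
  finally show ?thesis .
qed

lemma lucas_frobenius_diff_cong:
  assumes "prime p" "p ^ a = 2 * h + 1" "h > 0"
  shows "[(m * (m - 4)) ^ h = lucas_int (m - 2) (int (p ^ a))] (mod int p)"
proof -
  have a: "a > 0" using assms(2,3) by (cases a) auto
  have p: "odd (p ^ a)" using assms(2) by simp
  \<comment> \<open>The 2 is \<open>U(1) - U(-1)\<close>. On the other side the extreme terms give
    \<open>U(q) - U(-q) = 2 U(q)\<close>, as \<open>q\<close> is odd.\<close>
  have "2 * (m * (m - 4)) ^ h = (two_shift (- 1) 1 (- 1) ^^ (p ^ a)) (lucas_int (m - 2)) 0"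
    unfolding assms(2) two_shift_funpow_odd[OF two_shift_sq_lucas_int_diff]
    using lucas_int_uminus[of "m - 2" 1]
    by (simp add: two_shift_def)
  also have "[\<dots> = 2 * lucas_int (m - 2) (int (p ^ a))] (mod int p)"
    unfolding two_shift_funpow
    by (rule cong_trans[OF sum_prime_power_choose_cong[OF assms(1) a]])
       (use p a in \<open>simp add: lucas_int_uminus del: of_nat_power\<close>)
  finally have "[2 * (m * (m - 4)) ^ h = 2 * lucas_int (m - 2) (int (p ^ a))] (mod int p)" .
  moreover have "coprime 2 (int p)"
    using p a by simp
  ultimately show ?thesis using cong_mult_lcancel by blast
qed

section \<open>Polynomial congruences modulo a square\<close>

text \<open>The three cases serve the symbol values \<open>e = 1\<close>, \<open>-1\<close> and
  \<open>0\<close>, with \<open>a = U(h)\<close> and \<open>b = U(h + 1)\<close>; each right-hand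
  side is \<open>M^2 (e + U(q - e))\<close> written in \<open>a\<close> and \<open>b\<close>. In the
  first two, Cassini's identity gives the terms of first order in \<open>P\<close> a second factor
  \<open>P\<close>.\<close>

lemma central_binomial_sum_cong_algebra:
  fixes a b e A M P :: int
  assumes "b\<^sup>2 - A * a * b + a\<^sup>2 = 1"
  shows "P dvd a \<Longrightarrow> [M = b - a] (mod P) \<Longrightarrow>
      [2 * M * (a + b) - (b\<^sup>2 - a\<^sup>2) = M\<^sup>2 * (1 + (2 * a * b - A * a\<^sup>2))] (mod P\<^sup>2)"
    and "P dvd b \<Longrightarrow> [M = b - a] (mod P) \<Longrightarrow>
      [2 * M * (a + b) - (b\<^sup>2 - a\<^sup>2) = M\<^sup>2 * (- 1 + (A * b\<^sup>2 - 2 * a * b))] (mod P\<^sup>2)"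
    and "P dvd a + b \<Longrightarrow> [b - a = 1] (mod P) \<Longrightarrow> [M = 1] (mod P) \<Longrightarrow>
      [2 * M * (a + b) - (b\<^sup>2 - a\<^sup>2) = M\<^sup>2 * (b\<^sup>2 - a\<^sup>2)] (mod P\<^sup>2)"
proof -
  assume "P dvd a" "[M = b - a] (mod P)"
  then obtain t s where t: "a = P * t" and s: "M - (b - a) = P * s"
    by (auto simp: cong_iff_dvd_diff dvd_def)
  define r where "r = s - t"
  have M: "M = b + P * r"
    using t s unfolding r_def by (simp add: algebra_simps)
  have b: "1 - b\<^sup>2 = P * (P * t\<^sup>2 - A * t * b)"
    using assms unfolding t by (simp add: algebra_simps power2_eq_square)
  have "2 * M * (a + b) - (b\<^sup>2 - a\<^sup>2) - M\<^sup>2 * (1 + (2 * a * b - A * a\<^sup>2))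
     = 2 * b * P * t * (1 - b\<^sup>2) + P\<^sup>2 * (2*r*t + t\<^sup>2 - r\<^sup>2 - 2*t*b*r*(2*b + P*r) + A*t\<^sup>2*M\<^sup>2)"
    unfolding M t by (simp add: algebra_simps power2_eq_square)
  also have "\<dots> = P\<^sup>2 * (2 * b * t * (P * t\<^sup>2 - A * t * b) + (2*r*t + t\<^sup>2 - r\<^sup>2 - 2*t*b*r*(2*b + P*r) + A*t\<^sup>2*M\<^sup>2))"
    unfolding b by (simp add: distrib_left power2_eq_square)
  finally show "[2 * M * (a + b) - (b\<^sup>2 - a\<^sup>2) = M\<^sup>2 * (1 + (2 * a * b - A * a\<^sup>2))] (mod P\<^sup>2)"
    by (simp add: cong_iff_dvd_diff)
next
  assume "P dvd b" "[M = b - a] (mod P)"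
  then obtain t s where t: "b = P * t" and s: "M - (b - a) = P * s"
    by (auto simp: cong_iff_dvd_diff dvd_def)
  define r where "r = s + t"
  have M: "M = P * r - a"
    using t s unfolding r_def by (simp add: algebra_simps)
  have a: "1 - a\<^sup>2 = P * (P * t\<^sup>2 - A * t * a)"
    using assms unfolding t by (simp add: algebra_simps power2_eq_square)
  have "2 * M * (a + b) - (b\<^sup>2 - a\<^sup>2) - M\<^sup>2 * (- 1 + (A * b\<^sup>2 - 2 * a * b))
     = - 2 * a * P * t * (1 - a\<^sup>2) + P\<^sup>2 * (2*a*t*r*(P*r - 2*a) + 2*r*t - t\<^sup>2 + r\<^sup>2 - A*t\<^sup>2*M\<^sup>2)"
    unfolding M t by (simp add: algebra_simps power2_eq_square)
  also have "\<dots> = P\<^sup>2 * (- 2 * a * t * (P * t\<^sup>2 - A * t * a) + (2*a*t*r*(P*r - 2*a) + 2*r*t - t\<^sup>2 + r\<^sup>2 - A*t\<^sup>2*M\<^sup>2))"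
    unfolding a by (simp add: algebra_simps power2_eq_square)
  finally show "[2 * M * (a + b) - (b\<^sup>2 - a\<^sup>2) = M\<^sup>2 * (- 1 + (A * b\<^sup>2 - 2 * a * b))] (mod P\<^sup>2)"
    by (simp add: cong_iff_dvd_diff)
next
  assume "P dvd a + b" "[b - a = 1] (mod P)" "[M = 1] (mod P)"
  then obtain t s r where t: "a + b = P * t" and s: "b - a - 1 = P * s" and r: "M - 1 = P * r"
    by (auto simp: cong_iff_dvd_diff dvd_def)
  \<comment> \<open>The difference factors into \<open>a + b\<close> and an expression in
    \<open>M - 1\<close> and \<open>b - a - 1\<close>, both multiples of \<open>P\<close>.\<close>
  have "2 * M * (a + b) - (b\<^sup>2 - a\<^sup>2) - M\<^sup>2 * (b\<^sup>2 - a\<^sup>2)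
      = - (a + b) * ((M - 1)\<^sup>2 + (b - a - 1) * (1 + M\<^sup>2))"
    by (simp add: algebra_simps power2_eq_square)
  also have "\<dots> = P\<^sup>2 * (- t * (P * r\<^sup>2 + s * (1 + M\<^sup>2)))"
    unfolding t s r by (simp add: algebra_simps power2_eq_square)
  finally show "[2 * M * (a + b) - (b\<^sup>2 - a\<^sup>2) = M\<^sup>2 * (b\<^sup>2 - a\<^sup>2)] (mod P\<^sup>2)"
    by (simp add: cong_iff_dvd_diff)
qed

text \<open>The left-hand side is twice the expression arising for \<open>d = 1\<close>, with
  \<open>A * a - b\<close> as \<open>U(h - 1)\<close>; the right-hand side reuses the one for
  \<open>d = 0\<close>. They differ by multiples of squares of multiples of \<open>P\<close> and by
  a multiple of Cassini's identity. The factor 2 avoids halving \<open>A\<close>.\<close>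

lemma shifted_binomial_sum_cong_algebra:
  fixes a b m A M P :: int
  assumes cassini: "b\<^sup>2 - A * a * b + a\<^sup>2 = 1" and A: "A = m - 2"
    and "[M = b - a] (mod P)" and "[M\<^sup>2 = 1] (mod P)"
  shows "[2 * (2 * (M * (a + (A * a - b)) + 1) - (2 * a * b - A * a\<^sup>2))
     = 2 * M\<^sup>2 * (1 - M\<^sup>2) + A * ((2 * M * (a + b) - (b\<^sup>2 - a\<^sup>2)) - M\<^sup>2)] (mod P\<^sup>2)"
proof -
  obtain s t where s: "M - (b - a) = P * s" and t: "M\<^sup>2 - 1 = P * t"
    using assms(3,4) by (auto simp: cong_iff_dvd_diff dvd_def)
  have "2 * (2 * (M * (a + (A * a - b)) + 1) - (2 * a * b - A * a\<^sup>2))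
      - (2 * M\<^sup>2 * (1 - M\<^sup>2) + A * ((2 * M * (a + b) - (b\<^sup>2 - a\<^sup>2)) - M\<^sup>2))
     = m * (M - (b - a))\<^sup>2 + 2 * (M\<^sup>2 - 1)\<^sup>2 + 2 * (1 - (b\<^sup>2 - A * a * b + a\<^sup>2))"
    unfolding A by (simp add: algebra_simps power2_eq_square)
  also have "\<dots> = P\<^sup>2 * (m * s\<^sup>2 + 2 * t\<^sup>2)"
    unfolding s t cassini by (simp add: algebra_simps)
  finally show ?thesis by (simp add: cong_iff_dvd_diff)
qed

section \<open>Euler's criterion for prime powers\<close>

lemma Legendre_cases:
  obtains "Legendre x p = 1" | "Legendre x p = 0" | "Legendre x p = - 1"
  unfolding Legendre_def by presburger

text \<open>With \<open>k\<close> and \<open>g\<close> the halves of \<open>p ^ a - 1\<close> and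
  \<open>p - 1\<close>, the next exponent is \<open>k * p + g\<close>; the \<open>p\<close>-th power
  fixes -1, 0 and 1 because \<open>p\<close> is odd.\<close>

lemma euler_criterion_prime_power:
  assumes "prime p" "odd p" "p ^ a = 2 * h + 1"
  shows "[x ^ h = Legendre x (int p) ^ a] (mod int p)"
  using assms(3)
proof (induction a arbitrary: h)
  case 0
  then show ?case by simp
next
  case (Suc a)
  let ?L = "Legendre x (int p)"
  obtain k where k: "p ^ a = 2 * k + 1"
    using assms(2) by (metis oddE even_power)
  obtain g where g: "p = 2 * g + 1" using assms(2) by (rule oddE)
  have "2 < p" using assms(1,2) prime_ge_2_nat[of p] by (cases "p = 2") auto
  then have "[?L = x ^ ((p - 1) div 2)] (mod int p)"
    using euler_criterion assms(1) by blast
  moreover have "(p - 1) div 2 = g" using g by simp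
  ultimately have g': "[x ^ g = ?L] (mod int p)" by (simp add: cong_sym)
  have "2 * h + 1 = p * (2 * k + 1)" using Suc.prems k by simp
  also have "\<dots> = 2 * (k * p + g) + 1" using g by (simp add: algebra_simps)
  finally have "h = k * p + g" by simp
  then have "x ^ h = (x ^ k) ^ p * x ^ g" by (simp add: power_add power_mult)
  also have "[\<dots> = (?L ^ a) ^ p * ?L] (mod int p)"
    by (intro cong_mult cong_pow Suc.IH k g')
  also have "(?L ^ a) ^ p * ?L = ?L ^ Suc a"
  proof (cases rule: Legendre_cases[of x "int p"])
    case 3
    then show ?thesis using assms(2) by (simp flip: power_mult) (simp add: power_mult mult.commute[of a])
  qed (use g in auto)
  finally show ?case .
qed

lemma fermat_prime_power:
  assumes "prime p" "odd p" "p ^ a = 2 * h + 1" "\<not> int p dvd x"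
  shows "[(x ^ h)\<^sup>2 = 1] (mod int p)"
proof -
  have "Legendre x (int p) \<noteq> 0"
    using assms(4) by (auto simp: Legendre_def cong_0_iff split: if_splits)
  then have "(Legendre x (int p) ^ a)\<^sup>2 = 1"
    by (cases rule: Legendre_cases[of x "int p"]) (auto simp flip: power_mult)
  then show ?thesis
    using cong_pow[OF euler_criterion_prime_power[OF assms(1-3), of x], of 2] by simp
qed

section \<open>Lucas numbers near half the prime power\<close>

text \<open>For the case \<open>p dvd m - 4\<close>, where the parameter \<open>m - 2\<close> is
  congruent to 2 and the sequence becomes \<open>n\<close> itself.\<close>

lemma lucas_u_parameter_cong:
  assumes "[A = B] (mod P)"
  shows "[lucas_u A 1 n = lucas_u B 1 n] (mod P)"
  using assms by (induction A "1 :: int" n rule: lucas_u.induct) (auto intro!: cong_diff cong_mult)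

lemma lucas_u_2_1: "lucas_u 2 1 n = int n"
  by (induction "2 :: int" "1 :: int" n rule: lucas_u.induct) auto

text \<open>The two Frobenius congruences give \<open>M (x + y) = y^2 - x^2 = e\<close> modulo
  \<open>p\<close>. If \<open>e\<close> is nonzero, cancelling \<open>x + y\<close> gives the first
  claim, and \<open>p\<close> divides \<open>x\<close> or \<open>y\<close> according to the sign of
  \<open>e\<close>. If \<open>e = 0\<close>, then \<open>m = 4\<close> modulo \<open>p\<close>, so
  \<open>U(n) = n\<close> and \<open>M = 1\<close>. The last two claims make
  \<open>p ^ a - e\<close> a period of \<open>U\<close> modulo \<open>p\<close>.\<close>

lemma lucas_half_index_cong:
  fixes m :: int and p h :: nat
  defines "U \<equiv> lucas_int (m - 2)"
  assumes p: "prime p" "odd p" and q: "p ^ a = 2 * h + 1" "h > 0"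
    and m: "\<not> int p dvd m" and e: "e = Legendre (m * (m - 4)) (int p) ^ a"
  shows "[m ^ h = U (int h + 1) - U (int h)] (mod int p)"
    and "[2 * m ^ h * (U (int h) + U (int h + 1)) - U (int (p ^ a))
          = (m ^ h)\<^sup>2 * (e + U (int (p ^ a) - e))] (mod (int p)\<^sup>2)"
    and "int p dvd U (int (p ^ a) - e)"
    and "[U (int (p ^ a) - e - 1) = - 1] (mod int p)"
proof -
  define x y M A P where "x = U (int h)" and "y = U (int h + 1)" and "M = m ^ h"
    and "A = m - 2" and "P = int p"
  note defs = x_def y_def M_def A_def P_def
  have a: "a > 0" using q by (cases a) auto
  have cassini: "y\<^sup>2 - A * x * y + x\<^sup>2 = 1"
    using lucas_int_cassini[of A "int h"] by (simp add: defs U_def)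
  have Uq: "U (int (p ^ a)) = y\<^sup>2 - x\<^sup>2"
    using lucas_int_odd_index[of A "int h"] unfolding q by (simp add: defs U_def algebra_simps)
  have M2: "[M\<^sup>2 = 1] (mod P)"
    using fermat_prime_power[OF p q(1) m] by (simp add: defs)
  have F1: "[M * (x + y) = y\<^sup>2 - x\<^sup>2] (mod P)"
    using lucas_frobenius_sum_cong[OF p(1) q, of m] unfolding Uq[symmetric] by (simp add: defs U_def)
  have F2: "[y\<^sup>2 - x\<^sup>2 = e] (mod P)"
    using lucas_frobenius_diff_cong[OF p(1) q, of m]
      euler_criterion_prime_power[OF p q(1), of "m * (m - 4)"] cong_trans cong_sym
    unfolding Uq[symmetric] e P_def U_def by blast
  have P: "prime P" "\<not> P dvd 2"
    using p primes_dvd_imp_eq[of P 2] by (auto simp: P_def)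
  have half: "P dvd z" if "P dvd 2 * z" for z
    using that P prime_dvd_mult_iff by blast
  have nonzero: "[M = y - x] (mod P)" "[x + y = e * M] (mod P)" if "e \<noteq> 0" "e = 1 \<or> e = - 1"
  proof -
    have "\<not> P dvd e" using P(1) that by (auto simp: prime_int_iff)
    then have "\<not> P dvd x + y"
      using F2 by (metis cong_dvd_iff dvd_mult square_diff_square_factored power2_eq_square add.commute dvd_mult2)
    moreover have "P dvd (x + y) * (M - (y - x))"
      using F1 by (simp add: cong_iff_dvd_diff algebra_simps power2_eq_square)
    ultimately show "[M = y - x] (mod P)"
      using P(1) by (simp add: prime_dvd_mult_iff cong_iff_dvd_diff)
    \<comment> \<open>Multiplying by \<open>M\<close> solves for \<open>x + y\<close>, since
      \<open>M\<close> is its own inverse modulo \<open>P\<close>.\<close>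
    have "[M * (M * (x + y)) = M * e] (mod P)"
      by (intro cong_mult cong_refl cong_trans[OF F1 F2])
    moreover have "[M\<^sup>2 * (x + y) = 1 * (x + y)] (mod P)"
      by (intro cong_mult cong_refl M2)
    ultimately show "[x + y = e * M] (mod P)"
      by (metis cong_sym cong_trans mult.commute mult_1 power2_eq_square mult.assoc)
  qed
  consider (pos) "e = 1" | (zero) "e = 0" | (neg) "e = - 1"
    using power_minus[of "1 :: int" a] a unfolding e
    by (cases rule: Legendre_cases[of "m * (m - 4)" "int p"])
       (auto, metis minus_one_power_iff)
  then have "[M = y - x] (mod P)
    \<and> [2 * M * (x + y) - (y\<^sup>2 - x\<^sup>2) = M\<^sup>2 * (e + U (int (p ^ a) - e))] (mod P\<^sup>2)
    \<and> P dvd U (int (p ^ a) - e) \<and> [U (int (p ^ a) - e - 1) = - 1] (mod P)"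
  proof cases
    case pos
    have M: "[M = y - x] (mod P)" using nonzero(1) pos by simp
    \<comment> \<open>The sum equals \<open>2 * x\<close>; in the case \<open>e = - 1\<close> the
      analogous difference equals \<open>2 * y\<close>.\<close>
    have "P dvd (x + y - e * M) + (M - (y - x))"
      using M nonzero(2) pos by (intro dvd_add[of P "x + y - e * M"]) (auto simp: cong_iff_dvd_diff)
    then have x: "P dvd x" using half[of x] pos by (simp add: algebra_simps)
    have U: "U (int (p ^ a) - e) = 2 * x * y - A * x\<^sup>2"
      using lucas_int_even_index[of A "int h"] unfolding pos q by (simp add: defs U_def)
    have dvd: "P dvd U (int (p ^ a) - e)"
      unfolding U using x by (simp add: power2_eq_square)
    have "U (int (p ^ a) - e - 1) = A * U (int (p ^ a) - e) - U (int (p ^ a))"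
      using lucas_int_pred[of A "int (p ^ a) - 1"] unfolding pos U_def A_def by simp
    also have "[\<dots> = A * 0 - 1] (mod P)"
      using dvd F2 unfolding Uq pos by (intro cong_diff cong_mult cong_refl) (simp_all add: cong_0_iff)
    finally show ?thesis
      using M dvd central_binomial_sum_cong_algebra(1)[OF cassini x M] unfolding U unfolding pos by simp
  next
    case neg
    have M: "[M = y - x] (mod P)" using nonzero(1) neg by simp
    have "P dvd (x + y - e * M) - (M - (y - x))"
      using M nonzero(2) neg by (intro dvd_diff[of P "x + y - e * M"]) (auto simp: cong_iff_dvd_diff)
    then have y: "P dvd y" using half[of y] neg by (simp add: algebra_simps)
    have Uh2: "U (int h + 2) = A * y - x"
      using lucas_int_rec[of A "int h + 1"] by (simp add: defs U_def algebra_simps)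
    have "U (int (p ^ a) - e) = 2 * y * U (int h + 2) - A * y\<^sup>2"
      using lucas_int_even_index[of A "int h + 1"] unfolding neg q by (simp add: defs U_def algebra_simps)
    then have U: "U (int (p ^ a) - e) = A * y\<^sup>2 - 2 * x * y"
      unfolding Uh2 by (simp add: algebra_simps power2_eq_square)
    have dvd: "P dvd U (int (p ^ a) - e)"
      unfolding U using y by (simp add: power2_eq_square)
    have "[U (int (p ^ a) - e - 1) = - 1] (mod P)"
      using F2 Uq neg by simp
    then show ?thesis
      using M dvd central_binomial_sum_cong_algebra(2)[OF cassini y M] unfolding U unfolding neg by simp
  next
    case zero
    then have "Legendre (m * (m - 4)) P = 0" using e by (simp add: P_def)
    then have "P dvd m * (m - 4)" by (auto simp: Legendre_def cong_0_iff split: if_splits)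
    then have m4: "P dvd m - 4" using m P by (simp add: P_def prime_dvd_mult_iff)
    have A: "[A = 2] (mod P)" using m4 by (simp add: A_def cong_iff_dvd_diff)
    have Un: "[U (int n) = int n] (mod P)" for n
      using lucas_u_parameter_cong[OF A, of n] by (simp add: U_def A_def lucas_u_2_1)
    have x: "[x = int h] (mod P)" unfolding x_def by (rule Un)
    have y: "[y = int (h + 1)] (mod P)" using Un[of "h + 1"] by (simp add: y_def add.commute)
    have "p dvd p ^ a" using a by (simp add: dvd_power)
    then have "P dvd int (2 * h + 1)" unfolding q P_def by (simp only: of_nat_dvd_iff)
    then have Ph: "P dvd 2 * int h + 1" by (simp add: add.commute)
    have "[x + y = int h + int (h + 1)] (mod P)" by (intro cong_add x y)
    then have xy: "P dvd x + y" using Ph by (simp add: cong_dvd_iff)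
    have yx: "[y - x = 1] (mod P)" using cong_diff[OF y x] by simp
    have "[M = 4 ^ h] (mod P)"
      using m4 unfolding M_def by (intro cong_pow) (simp add: cong_iff_dvd_diff)
    also have "4 ^ h = ((2 :: int) ^ h)\<^sup>2" by (simp add: power_mult[symmetric] mult.commute[of h] power_mult)
    also have "[\<dots> = 1] (mod P)"
      unfolding P_def by (rule fermat_prime_power[OF p q(1)]) (use P in \<open>simp add: P_def\<close>)
    finally have M: "[M = 1] (mod P)" .
    have dvd: "P dvd U (int (p ^ a))" using F2 unfolding Uq zero by (simp add: cong_0_iff)
    have "int (p ^ a) - e - 1 = int (2 * h)" using zero q by simp
    then have "[U (int (p ^ a) - e - 1) = int (2 * h)] (mod P)" using Un by presburger
    also have "[int (2 * h) = - 1] (mod P)"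
      using Ph by (simp add: cong_iff_dvd_diff)
    finally show ?thesis
      using cong_trans[OF M cong_sym[OF yx]] dvd
        central_binomial_sum_cong_algebra(3)[OF cassini xy yx M] unfolding zero
      by (simp add: Uq del: of_nat_power)
  qed
  then show "[m ^ h = U (int h + 1) - U (int h)] (mod int p)"
    "[2 * m ^ h * (U (int h) + U (int h + 1)) - U (int (p ^ a))
          = (m ^ h)\<^sup>2 * (e + U (int (p ^ a) - e))] (mod (int p)\<^sup>2)"
    "int p dvd U (int (p ^ a) - e)"
    "[U (int (p ^ a) - e - 1) = - 1] (mod int p)"
    unfolding Uq unfolding defs by blast+
qed

section \<open>Lucas numbers at multiples of a period\<close>

text \<open>The hypotheses make \<open>N\<close> a period modulo \<open>P\<close>. In the addition
  formula for \<open>U(k N + N)\<close> each product has a factor divisible by \<open>P\<close>, so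
  the other factor matters only modulo \<open>P\<close>; hence the second conjunct is carried along
  at lower precision.\<close>

lemma lucas_multiple_index_cong:
  assumes "P dvd lucas_int A N" "[lucas_int A (N - 1) = - 1] (mod P)"
  shows "[lucas_int A (int k * N) = int k * lucas_int A N] (mod P\<^sup>2)
    \<and> [lucas_int A (int k * N + 1) = 1] (mod P)"
proof (induction k)
  case 0
  then show ?case by simp
next
  case (Suc k)
  let ?U = "lucas_int A"
  obtain s where s: "?U N = P * s" using assms(1) by blast
  obtain t where t: "?U (N - 1) = - 1 + P * t"
    using assms(2) by (metis cong_iff_lin cong_sym)
  obtain r where r: "?U (int k * N) = int k * (P * s) + P\<^sup>2 * r"
    using Suc unfolding s by (metis cong_iff_lin cong_sym)
  obtain v where v: "?U (int k * N + 1) = 1 + P * v"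
    using Suc by (metis cong_iff_lin cong_sym)
  have "?U (int (Suc k) * N) = ?U (int k * N + N)" by (simp add: algebra_simps)
  also have "\<dots> = ?U (int k * N + 1) * ?U N - ?U (int k * N) * ?U (N - 1)"
    by (rule lucas_int_add)
  also have "\<dots> - int (Suc k) * ?U N = P\<^sup>2 * (v * s + r - (int k * s + P * r) * t)"
    unfolding s t r v by (simp add: algebra_simps power2_eq_square)
  finally have 1: "[?U (int (Suc k) * N) = int (Suc k) * ?U N] (mod P\<^sup>2)"
    by (simp add: cong_iff_dvd_diff)
  have "?U (int (Suc k) * N + 1) = ?U (int k * N + (N + 1))" by (simp add: algebra_simps)
  also have "\<dots> = ?U (int k * N + 1) * ?U (N + 1) - ?U (int k * N) * ?U N"
    using lucas_int_add[of A "int k * N" "N + 1"] by simp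
  also have "?U (N + 1) = A * ?U N - ?U (N - 1)" by (rule lucas_int_rec)
  also have "?U (int k * N + 1) * (A * ?U N - ?U (N - 1)) - ?U (int k * N) * ?U N - 1
      = P * ((1 + P * v) * (A * s - t) + v - (int k * (P * s) + P\<^sup>2 * r) * s)"
    unfolding s t r v by (simp add: algebra_simps power2_eq_square)
  finally have "[?U (int (Suc k) * N + 1) = 1] (mod P)"
    by (simp add: cong_iff_dvd_diff)
  with 1 show ?case by blast
qed

text \<open>The quotient is the sum of all \<open>p ^ i * e ^ (a - i)\<close>, whose only term
  without a factor \<open>p\<close> is \<open>e ^ a\<close>.\<close>

lemma prime_power_diff_factor:
  fixes p e :: int
  shows "\<exists>k. p ^ Suc a - e ^ Suc a = k * (p - e) \<and> [k = e ^ a] (mod p)"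
proof (induction a)
  case 0
  show ?case by (intro exI[of _ 1]) simp
next
  case (Suc a)
  then obtain k where k: "p ^ Suc a - e ^ Suc a = k * (p - e)" "[k = e ^ a] (mod p)" by blast
  have "p ^ Suc (Suc a) - e ^ Suc (Suc a) = p ^ Suc a * (p - e) + e * (p ^ Suc a - e ^ Suc a)"
    by (simp add: algebra_simps)
  also have "\<dots> = (p ^ Suc a + e * k) * (p - e)"
    unfolding k by (simp add: algebra_simps)
  finally have "p ^ Suc (Suc a) - e ^ Suc (Suc a) = (p ^ Suc a + e * k) * (p - e)" .
  moreover have "[p ^ Suc a + e * k = 0 + e * e ^ a] (mod p)"
    by (intro cong_add cong_mult cong_refl k) (simp add: cong_0_iff)
  ultimately show ?case by (intro exI[of _ "p ^ Suc a + e * k"]) simp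
qed

text \<open>The index is \<open>k * (p - e)\<close> with \<open>k = e ^ a\<close> modulo
  \<open>p\<close>; this precision suffices because \<open>U(p - e)\<close> supplies the second
  factor \<open>p\<close>.\<close>

lemma lucas_prime_power_index_cong:
  fixes m :: int
  assumes p: "prime p" "odd p" and m: "\<not> int p dvd m" and e: "e = Legendre (m * (m - 4)) (int p)"
  shows "[lucas_int (m - 2) (int (p ^ Suc a) - e ^ Suc a)
    = e ^ a * lucas_int (m - 2) (int p - e)] (mod (int p)\<^sup>2)"
proof -
  let ?U = "lucas_int (m - 2)"
  obtain h where h: "p = 2 * h + 1" using p(2) by (rule oddE)
  have "p > 1" using p(1) prime_gt_1_nat by blast
  then have "h > 0" using h by simp
  note facts = lucas_half_index_cong(3,4)[OF p, of 1 h m e]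
  have dvd: "int p dvd ?U (int p - e)" and prev: "[?U (int p - e - 1) = - 1] (mod int p)"
    using facts \<open>h > 0\<close> h m e by auto
  obtain k where k: "int p ^ Suc a - e ^ Suc a = k * (int p - e)" "[k = e ^ a] (mod int p)"
    using prime_power_diff_factor by blast
  have e1: "e \<le> 1" "e ^ Suc a \<le> 1"
    unfolding e by (cases rule: Legendre_cases[of "m * (m - 4)" "int p"];
      auto simp: minus_one_power_iff)+
  have "int p ^ Suc a \<ge> 1" using \<open>p > 1\<close> by (intro one_le_power) simp
  \<comment> \<open>The sign of \<open>k\<close> matters because
    \<open>lucas_multiple_index_cong\<close> speaks of natural multiples.\<close>
  then have "0 \<le> k * (int p - e)" using e1 unfolding k(1)[symmetric] by linarith
  moreover have "0 < int p - e" using \<open>p > 1\<close> e1 by linarith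
  ultimately have "k \<ge> 0" by (simp add: zero_le_mult_iff)
  then obtain n where n: "k = int n" using nonneg_int_cases by blast
  have "[?U (int n * (int p - e)) = int n * ?U (int p - e)] (mod (int p)\<^sup>2)"
    using lucas_multiple_index_cong[OF dvd prev] by blast
  also have "[int n * ?U (int p - e) = e ^ a * ?U (int p - e)] (mod (int p)\<^sup>2)"
    using k(2) dvd unfolding n
    by (simp add: cong_iff_dvd_diff power2_eq_square mult_dvd_mono flip: left_diff_distrib)
  finally show ?thesis using k(1) n by simp
qed

section \<open>Powers of \<open>m\<close> modulo the square of \<open>p\<close>\<close>

text \<open>The cofactor of \<open>x - y\<close> in \<open>x ^ n - y ^ n\<close> is congruent to
  \<open>n * y ^ (n - 1)\<close>, so both factors are multiples of \<open>n\<close>.\<close>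

lemma cong_power_self_sq:
  fixes x y :: int
  assumes "[x = y] (mod int n)"
  shows "[x ^ n = y ^ n] (mod (int n)\<^sup>2)"
proof -
  have "[(\<Sum>i<n. y ^ (n - Suc i) * x ^ i) = (\<Sum>i<n. y ^ (n - Suc i) * y ^ i)] (mod int n)"
    by (intro cong_sum cong_mult cong_pow cong_refl assms)
  also have "(\<Sum>i<n. y ^ (n - Suc i) * y ^ i) = (\<Sum>i<n. y ^ (n - 1))"
    by (intro sum.cong) (auto simp flip: power_add)
  also have "\<dots> = int n * y ^ (n - 1)" by simp
  finally have "int n dvd (\<Sum>i<n. y ^ (n - Suc i) * x ^ i)"
    using cong_dvd_iff dvd_triv_left by blast
  with assms show ?thesis
    by (simp add: cong_iff_dvd_diff power_diff_sumr2 power2_eq_square mult_dvd_mono)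
qed

text \<open>Fermat gives \<open>m ^ (p ^ (a - 1)) = m\<close> modulo \<open>p\<close>; the
  \<open>p\<close>-th power lifts this to modulo \<open>p ^ 2\<close>, and cancelling
  \<open>m\<close> leaves the exponents \<open>p ^ a - 1\<close> and \<open>p - 1\<close>.\<close>

lemma power_prime_power_pred_cong:
  fixes m :: int
  assumes p: "prime p" "odd p" and q: "p ^ a = 2 * h + 1" "h > 0" and m: "\<not> int p dvd m"
  shows "[(m ^ h)\<^sup>2 = m ^ (p - 1)] (mod (int p)\<^sup>2)"
proof -
  obtain b where b: "a = Suc b" using q by (cases a) auto
  obtain g where g: "p ^ b = 2 * g + 1" using p(2) by (metis oddE even_power)
  have "[m * (m ^ g)\<^sup>2 = m * 1] (mod int p)"
    by (intro cong_mult cong_refl fermat_prime_power[OF p g m])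
  then have "[(m * (m ^ g)\<^sup>2) ^ p = m ^ p] (mod (int p)\<^sup>2)"
    using cong_power_self_sq by fastforce
  moreover have "(m * (m ^ g)\<^sup>2) ^ p = m * (m ^ h)\<^sup>2"
  proof -
    have "(m * (m ^ g)\<^sup>2) ^ p = (m ^ (2 * g + 1)) ^ p" by (simp add: power_mult mult.commute power_even_eq)
    also have "\<dots> = m ^ (p ^ a)" unfolding g[symmetric] b by (simp flip: power_mult add: mult.commute)
    finally show ?thesis unfolding q by (simp add: power_mult mult.commute[of 2])
  qed
  moreover have "m ^ p = m * m ^ (p - 1)"
    using p(1) prime_gt_0_nat by (metis power_eq_if not_gr_zero)
  ultimately have "[m * (m ^ h)\<^sup>2 = m * m ^ (p - 1)] (mod (int p)\<^sup>2)" by simp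
  moreover have "coprime m ((int p)\<^sup>2)"
    using m p(1) prime_imp_coprime[of "int p" m] by (simp add: coprime_commute)
  ultimately show ?thesis by (simp add: cong_mult_lcancel)
qed

section \<open>Transfer to the rationals\<close>

text \<open>The reduced denominator divides \<open>c\<close>.\<close>

lemma p_integral_divide:
  assumes "\<not> int p dvd c" "prime p"
  shows "p_integral p (of_int z / of_int c)"
proof -
  obtain n d where nd: "quotient_of (of_int z / of_int c) = (n, d)" by fastforce
  have c: "c \<noteq> 0" using assms by auto
  have d: "d > 0" using nd quotient_of_denom_pos by blast
  have "of_int z / of_int c = (of_int n / of_int d :: rat)" using nd quotient_of_div by blast
  then have "(of_int (z * d) :: rat) = of_int (n * c)"
    using c d by (simp add: field_simps)
  then have "z * d = n * c" by (simp only: of_int_eq_iff)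
  then have "d dvd n * c" by (metis dvd_triv_right)
  moreover have "coprime d n" using nd quotient_of_coprime coprime_commute by blast
  ultimately have "d dvd c" by (simp add: coprime_dvd_mult_right_iff)
  then have "\<not> int p dvd d" using assms(1) dvd_trans by blast
  then show ?thesis
    unfolding p_integral_def nd using assms(2) prime_imp_coprime[of "int p" d]
    by (simp add: coprime_commute)
qed

lemma rat_cong_sqI:
  assumes "prime p" "\<not> int p dvd c" "of_int c * (x - y) = of_int (z - w)" "[z = w] (mod (int p)\<^sup>2)"
  shows "rat_cong_sq p x y"
proof -
  obtain k where k: "z - w = (int p)\<^sup>2 * k"
    using assms(4) by (auto simp: cong_iff_dvd_diff)
  have "c \<noteq> 0" using assms(2) by auto
  then have "x - y = of_nat p ^ 2 * (of_int k / of_int c)"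
    using assms(3) unfolding k by (simp add: field_simps)
  then show ?thesis
    unfolding rat_cong_sq_def using p_integral_divide[OF assms(2,1)] by blast
qed

lemma p_integral_fraction:
  assumes "p_integral p x" "prime p"
  obtains z c where "x = of_int z / of_int c" "\<not> int p dvd c"
proof -
  obtain n d where nd: "quotient_of x = (n, d)" by fastforce
  then have "\<not> int p dvd d"
    using assms by (auto simp: p_integral_def coprime_absorb_right)
  then show ?thesis using that nd quotient_of_div by blast
qed

lemma rat_cong_sq_add:
  assumes "prime p" "rat_cong_sq p x y" "rat_cong_sq p x' y'"
  shows "rat_cong_sq p (x + x') (y + y')"
proof -
  obtain z z' where z: "p_integral p z" "x - y = of_nat p ^ 2 * z"
    "p_integral p z'" "x' - y' = of_nat p ^ 2 * z'"
    using assms unfolding rat_cong_sq_def by blast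
  obtain n c where nc: "z = of_int n / of_int c" "\<not> int p dvd c"
    using p_integral_fraction z(1) assms(1) by blast
  obtain n' c' where nc': "z' = of_int n' / of_int c'" "\<not> int p dvd c'"
    using p_integral_fraction z(3) assms(1) by blast
  have "c \<noteq> 0" "c' \<noteq> 0" using nc nc' by auto
  then have "z + z' = of_int (n * c' + n' * c) / of_int (c * c')"
    unfolding nc nc' by (simp add: field_simps)
  moreover have "\<not> int p dvd c * c'" using nc nc' assms(1) by (simp add: prime_dvd_mult_iff)
  ultimately have "p_integral p (z + z')" using p_integral_divide assms(1) by metis
  moreover have "(x + x') - (y + y') = of_nat p ^ 2 * (z + z')" using z by (simp add: algebra_simps)
  ultimately show ?thesis unfolding rat_cong_sq_def by blast
qed

lemma rat_cong_sq_minus: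
  assumes "prime p" "rat_cong_sq p x y"
  shows "rat_cong_sq p (- x) (- y)"
proof -
  obtain z where z: "p_integral p z" "x - y = of_nat p ^ 2 * z"
    using assms unfolding rat_cong_sq_def by blast
  obtain n c where nc: "z = of_int n / of_int c" "\<not> int p dvd c"
    using p_integral_fraction z(1) assms(1) by blast
  have "- z = of_int (- n) / of_int c" by (simp add: nc)
  then have "p_integral p (- z)" using p_integral_divide nc(2) assms(1) by metis
  moreover have "- x - - y = of_nat p ^ 2 * (- z)" using z by (simp add: algebra_simps)
  ultimately show ?thesis unfolding rat_cong_sq_def by blast
qed

lemma rat_cong_sq_diff:
  assumes "prime p" "rat_cong_sq p x y" "rat_cong_sq p x' y'"
  shows "rat_cong_sq p (x - x') (y - y')"
  using rat_cong_sq_add[OF assms(1,2) rat_cong_sq_minus[OF assms(1,3)]] by simp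

section \<open>The two basic sums with denominators cleared\<close>

text \<open>\<open>S d\<close> is the rational sum times \<open>m ^ (p ^ a - 1)\<close>, where
  \<open>p ^ a - 1 = 2 * h\<close>. The second congruence is doubled because
  \<open>m / 2 - 1\<close> need not be an integer.\<close>

lemma central_binomial_sums_cong:
  fixes m :: int and p h a :: nat
  assumes p: "prime p" "odd p" and q: "p ^ a = 2 * h + 1" "h > 0" and m: "\<not> int p dvd m"
    and L: "L = Legendre (m * (m - 4)) (int p)"
  defines "E \<equiv> L ^ a + L ^ (a - 1) * lucas_int (m - 2) (int p - L)"
    and "S \<equiv> \<lambda>d. \<Sum>k<p ^ a. int ((2 * k) choose (k + d)) * m ^ (p ^ a - 1 - k)"
  shows "[S 0 = m ^ (2 * h) * E] (mod (int p)\<^sup>2)"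
    and "[2 * S 1 = m ^ (2 * h) * (2 * (1 - m ^ (p - 1)) + (m - 2) * (E - 1))] (mod (int p)\<^sup>2)"
proof -
  let ?U = "lucas_int (m - 2)"
  define x y M where "x = ?U (int h)" and "y = ?U (int h + 1)" and "M = m ^ h"
  obtain b where b: "a = Suc b" using q by (cases a) auto
  note half = lucas_half_index_cong[OF p q m refl, folded x_def y_def M_def L]
  have cassini: "y\<^sup>2 - (m - 2) * x * y + x\<^sup>2 = 1"
    using lucas_int_cassini[of "m - 2" "int h"] by (simp add: x_def y_def)
  have Uq: "?U (int (p ^ a)) = y\<^sup>2 - x\<^sup>2"
    using lucas_int_odd_index[of "m - 2" "int h"] unfolding q by (simp add: x_def y_def algebra_simps)
  have Uq1: "?U (int (p ^ a) - 1) = 2 * x * y - (m - 2) * x\<^sup>2"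
    using lucas_int_even_index[of "m - 2" "int h"] unfolding q by (simp add: x_def y_def)
  have M2: "M\<^sup>2 = m ^ (2 * h)" by (simp add: M_def power_mult[symmetric] mult.commute)
  have E: "[L ^ a + ?U (int (p ^ a) - L ^ a) = E] (mod (int p)\<^sup>2)"
    unfolding E_def b using lucas_prime_power_index_cong[OF p m L, of b] by (intro cong_add) simp_all
  have S0: "[S 0 = 2 * M * (x + y) - (y\<^sup>2 - x\<^sup>2)] (mod (int p)\<^sup>2)"
    using lucas_sum_prime_power_cong[OF p(1) q, of 0 m]
    unfolding S_def central_sum_eq_lucas_sum of_nat_0 diff_0_right Uq
    by (simp add: x_def y_def M_def algebra_simps del: of_nat_power)
  have 0: "[2 * M * (x + y) - (y\<^sup>2 - x\<^sup>2) = M\<^sup>2 * E] (mod (int p)\<^sup>2)"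
    using cong_trans[OF half(2) cong_mult[OF cong_refl E]] unfolding Uq by simp
  show "[S 0 = m ^ (2 * h) * E] (mod (int p)\<^sup>2)"
    using cong_trans[OF S0 0] by (simp only: M2)
  have Uh: "?U (int h - 1) = (m - 2) * x - y"
    using lucas_int_pred[of "m - 2" "int h"] by (simp add: x_def y_def)
  \<comment> \<open>The summand 1 comes from the boundary value \<open>U(-1) = -1\<close>.\<close>
  have S1: "[S 1 = 2 * (M * (x + ((m - 2) * x - y)) + 1) - (2 * x * y - (m - 2) * x\<^sup>2)] (mod (int p)\<^sup>2)"
    using lucas_sum_prime_power_cong[OF p(1) q, of 1 m] lucas_int_uminus[of "m - 2" 1]
    unfolding S_def central_sum_eq_lucas_sum of_nat_1 Uq1 Uh
    by (simp add: x_def y_def M_def algebra_simps del: of_nat_power)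
  have "[2 * S 1 = 2 * (2 * (M * (x + ((m - 2) * x - y)) + 1) - (2 * x * y - (m - 2) * x\<^sup>2))] (mod (int p)\<^sup>2)"
    by (intro cong_mult cong_refl S1)
  also have "[2 * (2 * (M * (x + ((m - 2) * x - y)) + 1) - (2 * x * y - (m - 2) * x\<^sup>2))
      = 2 * M\<^sup>2 * (1 - M\<^sup>2) + (m - 2) * ((2 * M * (x + y) - (y\<^sup>2 - x\<^sup>2)) - M\<^sup>2)] (mod (int p)\<^sup>2)"
    using shifted_binomial_sum_cong_algebra[OF cassini refl half(1)] fermat_prime_power[OF p q(1) m]
    by (simp add: M_def)
  \<comment> \<open>Only the inner \<open>M^2\<close> becomes \<open>m ^ (p - 1)\<close>; the outer
    one stays as the common factor \<open>m ^ (2 * h)\<close>.\<close>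
  also have "[2 * M\<^sup>2 * (1 - M\<^sup>2) + (m - 2) * ((2 * M * (x + y) - (y\<^sup>2 - x\<^sup>2)) - M\<^sup>2)
      = 2 * M\<^sup>2 * (1 - m ^ (p - 1)) + (m - 2) * (M\<^sup>2 * E - M\<^sup>2)] (mod (int p)\<^sup>2)"
    using power_prime_power_pred_cong[OF p q m] unfolding M_def[symmetric]
    by (intro cong_add cong_diff cong_mult cong_refl 0)
  finally show "[2 * S 1 = m ^ (2 * h) * (2 * (1 - m ^ (p - 1)) + (m - 2) * (E - 1))] (mod (int p)\<^sup>2)"
    by (simp add: M2 algebra_simps)
qed

section \<open>Deduction of the four rational congruences\<close>

lemma sum_divide_power_eq:
  fixes m :: int and f :: "nat \<Rightarrow> nat"
  assumes "m \<noteq> 0"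
  shows "(\<Sum>k = 0..2 * h. of_nat (f k) / of_int m ^ k :: rat)
    = of_int (\<Sum>k<2 * h + 1. int (f k) * m ^ (2 * h - k)) / of_int (m ^ (2 * h))"
proof -
  have "of_nat (f k) / of_int m ^ k = (of_int (int (f k) * m ^ (2 * h - k)) / of_int (m ^ (2 * h)) :: rat)"
    if "k < 2 * h + 1" for k
  proof -
    have "m ^ (2 * h) = m ^ k * m ^ (2 * h - k)"
      using that by (simp flip: power_add)
    then show ?thesis using assms by simp
  qed
  moreover have "{0..2 * h} = {..<2 * h + 1}" by auto
  ultimately show ?thesis
    unfolding of_int_sum sum_divide_distrib by (intro sum.cong) auto
qed

theorem theorem1p1:
  fixes p a :: nat and m \<Delta> :: int
  assumes "prime p" and "odd p" and "a > 0" and "\<not> int p dvd m"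
    and "\<Delta> = m * (m - 4)"
  shows
    "rat_cong_sq p
       (\<Sum>k = 0..p ^ a - 1. of_nat ((2 * k) choose k) / of_int m ^ k)
       (of_int (Jacobi \<Delta> (p ^ a))
         + of_int (Jacobi \<Delta> (p ^ (a - 1)))
           * of_int (lucas_u (m - 2) 1 (nat (int p - Jacobi \<Delta> p))))
     \<and> rat_cong_sq p
       (\<Sum>k = 0..p ^ a - 1. of_nat ((2 * k) choose (k + 1)) / of_int m ^ k)
       (1 - of_int m ^ (p - 1)
         + (of_int m / 2 - 1) * (of_int (Jacobi \<Delta> (p ^ a)) - 1)
         + (of_int m / 2 - 1) * of_int (Jacobi \<Delta> (p ^ (a - 1)))
           * of_int (lucas_u (m - 2) 1 (nat (int p - Jacobi \<Delta> p))))
     \<and> rat_cong_sq p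
       ((\<Sum>k = 1..p ^ a - 1. of_nat ((2 * k + 1) choose k) / of_int m ^ k)
         + of_int m ^ (p - 1) - 1)
       (of_int m / 2
         * (of_int (Jacobi \<Delta> (p ^ a)) - 1
            + of_int (Jacobi \<Delta> (p ^ (a - 1)))
              * of_int (lucas_u (m - 2) 1 (nat (int p - Jacobi \<Delta> p)))))
     \<and> rat_cong_sq p
       (\<Sum>k = 1..p ^ a - 1. catalan k / of_int m ^ k)
       (of_int m ^ (p - 1) - 1
         - (of_int m - 4) / 2 * (of_int (Jacobi \<Delta> (p ^ a)) - 1)
         - (of_int m - 4) / 2 * of_int (Jacobi \<Delta> (p ^ (a - 1)))
           * of_int (lucas_u (m - 2) 1 (nat (int p - Jacobi \<Delta> p))))"
proof -
  define L where "L = Legendre \<Delta> (int p)"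
  define J where "J = L ^ a"
  define W where "W = L ^ (a - 1) * lucas_int (m - 2) (int p - L)"
  have "p > 2" using assms(1,2) prime_ge_2_nat[of p] by (cases "p = 2") auto
  have jac: "Jacobi \<Delta> (p ^ j) = L ^ j" for j
    using Jacobi_prime_power assms(1) by (simp add: L_def)
  have jac1: "Jacobi \<Delta> p = L" using jac[of 1] by simp
  \<comment> \<open>Hence \<open>p - L\<close> is positive and \<open>nat\<close> does not truncate
    it.\<close>
  have "L \<le> 1" unfolding L_def by (cases rule: Legendre_cases[of \<Delta> "int p"]) auto
  then have idx: "lucas_u (m - 2) 1 (nat (int p - L)) = lucas_int (m - 2) (int p - L)"
    using \<open>p > 2\<close> by (simp add: lucas_int_def)
  obtain h where h: "p ^ a = 2 * h + 1" using assms(2) by (metis oddE even_power)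
  have "p ^ a > 1" using \<open>p > 2\<close> assms(3) by (intro one_less_power) auto
  then have "h > 0" using h by simp
  have pred: "p ^ a - 1 = 2 * h" using h by simp
  have "m \<noteq> 0" using assms(4) by auto
  define S where "S d = (\<Sum>k<p ^ a. int ((2 * k) choose (k + d)) * m ^ (p ^ a - 1 - k))" for d
  define T where "T d = (\<Sum>k = 0..2 * h. of_nat ((2 * k) choose (k + d)) / of_int m ^ k :: rat)" for d
  have T: "T d = of_int (S d) / of_int (m ^ (2 * h))" for d
    unfolding T_def S_def pred unfolding h by (rule sum_divide_power_eq[OF \<open>m \<noteq> 0\<close>])
  note main = central_binomial_sums_cong[OF assms(1,2) h \<open>h > 0\<close> assms(4) L_def[unfolded assms(5)],
      folded S_def J_def W_def]
  \<comment> \<open>The second denominator also clears the 2 in \<open>m / 2 - 1\<close>.\<close>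
  have pm: "\<not> int p dvd m ^ (2 * h)" "\<not> int p dvd 2 * m ^ (2 * h)"
    using assms(1,4) prime_dvd_power[of "int p" m] \<open>p > 2\<close> zdvd_imp_le[of "int p" 2]
    by (auto simp: prime_dvd_mult_iff)
  have 0: "rat_cong_sq p (T 0) (of_int J + of_int W)"
    by (rule rat_cong_sqI[OF assms(1) pm(1) _ main(1)])
       (use \<open>m \<noteq> 0\<close> in \<open>simp add: T field_simps\<close>)
  have 1: "rat_cong_sq p (T 1) (1 - of_int m ^ (p - 1)
      + (of_int m / 2 - 1) * (of_int J - 1) + (of_int m / 2 - 1) * of_int W)"
    by (rule rat_cong_sqI[OF assms(1) pm(2) _ main(2)])
       (use \<open>m \<noteq> 0\<close> in \<open>simp add: T field_simps\<close>)
  have split: "(\<Sum>k = 0..2 * h. f k) = f 0 + (\<Sum>k = 1..2 * h. f k)" for f :: "nat \<Rightarrow> rat"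
    by (simp add: sum.atLeast_Suc_atMost)
  \<comment> \<open>At \<open>k = 0\<close> the summands are 1 and 0, which is the source of the
    \<open>- 1\<close> in both derived sums.\<close>
  have T0: "T 0 = 1 + (\<Sum>k = 1..2 * h. of_nat ((2 * k) choose k) / of_int m ^ k)"
    and T1: "T 1 = (\<Sum>k = 1..2 * h. of_nat ((2 * k) choose (k + 1)) / of_int m ^ k)"
    unfolding T_def split by simp_all
  have "(2 * k + 1) choose k = ((2 * k) choose k) + ((2 * k) choose (k + 1))" if "k \<ge> 1" for k
  proof -
    have "(2 * k + 1) choose k = (2 * k + 1) choose (k + 1)"
      using binomial_symmetric[of k "2 * k + 1"] by simp
    then show ?thesis by simp
  qed
  then have 2: "(\<Sum>k = 1..2 * h. of_nat ((2 * k + 1) choose k) / of_int m ^ k) = T 0 + T 1 - 1"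
    unfolding T0 T1 by (simp add: sum.distrib[symmetric] add_divide_distrib[symmetric])
  \<comment> \<open>Absorption turns the subtracted coefficient into \<open>k / (k + 1)\<close>
    times the central one, which leaves \<open>1 / (k + 1)\<close> of it.\<close>
  have "catalan k = of_nat ((2 * k) choose k) - of_nat ((2 * k) choose (k + 1))" for k
  proof -
    have "(k + 1) * ((2 * k) choose (k + 1)) = k * ((2 * k) choose k)"
      using binomial_absorb_comp[of "2 * k" k] binomial_absorption[of k "2 * k"]
      by (cases k) simp_all
    then have "of_nat (k + 1) * of_nat ((2 * k) choose (k + 1)) = (of_nat k * of_nat ((2 * k) choose k) :: rat)"
      by (metis of_nat_mult)
    then show ?thesis by (simp add: catalan_def field_simps)
  qed
  then have 3: "(\<Sum>k = 1..2 * h. catalan k / of_int m ^ k) = T 0 - T 1 - 1"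
    unfolding T0 T1 by (simp add: sum_subtractf[symmetric] diff_divide_distrib)
  have refl: "rat_cong_sq p z z" for z
    unfolding rat_cong_sq_def p_integral_def by (intro exI[of _ 0]) simp
  note cong = rat_cong_sq_add[OF assms(1)] rat_cong_sq_diff[OF assms(1)] refl
  have J: "of_int (Jacobi \<Delta> (p ^ a)) = (of_int J :: rat)" by (simp add: jac J_def)
  have W: "of_int (Jacobi \<Delta> (p ^ (a - 1))) * of_int (lucas_u (m - 2) 1 (nat (int p - Jacobi \<Delta> p)))
      = (of_int W :: rat)"
    by (simp add: jac jac1 idx W_def)
  have W': "z * of_int (Jacobi \<Delta> (p ^ (a - 1))) * of_int (lucas_u (m - 2) 1 (nat (int p - Jacobi \<Delta> p)))
      = z * (of_int W :: rat)" for z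
    by (simp add: W[symmetric])
  \<comment> \<open>The subtracted 2 joins the \<open>- 1\<close> from \<open>k = 0\<close> with the
    one in the claim; the powers \<open>m ^ (p - 1)\<close> cancel on the right.\<close>
  have "rat_cong_sq p (T 0 + T 1 - 1 + of_int m ^ (p - 1) - 1)
      (of_int m / 2 * (of_int J - 1 + of_int W))"
    using cong(2)[OF cong(1)[OF cong(1)[OF 0 1] refl[of "of_int m ^ (p - 1)"]] refl[of 2]]
    by (simp add: algebra_simps add_divide_distrib diff_divide_distrib)
  moreover have "rat_cong_sq p (T 0 - T 1 - 1)
      (of_int m ^ (p - 1) - 1 - (of_int m - 4) / 2 * (of_int J - 1) - (of_int m - 4) / 2 * of_int W)"
    using cong(2)[OF cong(2)[OF 0 1] refl[of 1]]
    by (simp add: field_simps)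
  ultimately show ?thesis
    unfolding W W' J pred 2 3 using 0 1 unfolding T_def by simp
qed

end
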